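(* Let $K$ be a (not necessarily commutative) field with centre $k$, of finite dimension $d$ over $k$, and let $(a_i)_{1\le i\le d}$, $a_i\in K$, be a basis of the $k$-vector space $K$. Then: (i) The family $(\sigma_{a_i})_{1\le i\le d}$ is a $K$-basis of the right $K$-vector space $\operatorname{End}_k(K)$. (ii) If $k\subset L\subset K$ is a (not necessarily commutative) subfield of $K$ containing the centre $k$, then its dimension and that of its commutant $C_K(L)$ in $K$ are related by $$\dim_k(C_K(L))\cdot\dim_k(L)=\dim_k(K).$$ In particular $d=n^2$: the dimension of $K$ over $k$ is the square of the dimension $n=\dim_k(L)$ of any maximal commutative subfield $L\subset K$.
   Context: A field is a division ring, multiplication not assumed commutative. The centre of $K$ is $Z(K)=\{z\in K: z\lambda=\lambda z\ \forall\lambda\in K\}$; the commutant of $L\subset K$ is $C_K(L)=\{z\in K: z\lambda=\lambda z\ \forall\lambda\in L\}$. $\operatorname{End}_k(K)$ is the group of $k$-linear endomorphisms of $K$, a right $K$-vector space via $(fb)(x)=f(x)b$ for $b\in K$. For $a\in K$, $\sigma_a\in\operatorname{End}_k(K)$ is left multiplication $\sigma_a(x)=ax$. "Maximal commutative subfield" means maximal for inclusion among commutative subfields of $K$. *)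

theory Defs
  imports Complex_Main "HOL-Library.Function_Algebras"
begin

definition commutant :: "'a::division_ring set \<Rightarrow> 'a set"
  where "commutant L = {z. \<forall>l\<in>L. z * l = l * z}"

definition subfield :: "'a::division_ring set \<Rightarrow> bool"
  where "subfield L \<longleftrightarrow> 0 \<in> L \<and> 1 \<in> L \<and>
    (\<forall>x\<in>L. \<forall>y\<in>L. x + y \<in> L \<and> x * y \<in> L) \<and>
    (\<forall>x\<in>L. - x \<in> L \<and> inverse x \<in> L)"

definition commutative_subfield :: "'a::division_ring set \<Rightarrow> bool"
  where "commutative_subfield L \<longleftrightarrow> subfield L \<and> (\<forall>x\<in>L. \<forall>y\<in>L. x * y = y * x)"

definition maximal_commutative_subfield :: "'a::division_ring set \<Rightarrow> bool"
  where "maximal_commutative_subfield L \<longleftrightarrow> commutative_subfield L \<and>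
    (\<forall>M. commutative_subfield M \<and> L \<subseteq> M \<longrightarrow> M = L)"

text \<open>
  The centre is made a type of class \<^class>\<open>field\<close>, so that \<open>K\<close> is a vector space over it
  in the sense of the library.  Its underlying set is \<open>range of_centre\<close>.
\<close>

typedef (overloaded) 'a centre = "{z::'a::division_ring. \<forall>x. z * x = x * z}"
  morphisms of_centre Abs_centre
  by (intro exI[of _ 0]) simp

setup_lifting type_definition_centre

lemma range_of_centre: "range of_centre = {z::'a::division_ring. \<forall>x. z * x = x * z}"
  by (rule type_definition.Rep_range[OF type_definition_centre])

lemma of_centre_commute: "of_centre c * x = x * of_centre c"
  using of_centre[of c] by simp

lemma central_inverse:
  fixes z :: "'a::division_ring"
  assumes z: "\<And>x. z * x = x * z"
  shows "inverse z * x = x * inverse z"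
proof (cases "z = 0")
  case False
  have "inverse z * x = inverse z * (x * z) * inverse z"
    using False by (simp add: mult.assoc)
  also have "\<dots> = inverse z * (z * x) * inverse z"
    by (simp only: z)
  also have "\<dots> = x * inverse z"
    using False by (simp flip: mult.assoc)
  finally show ?thesis .
qed simp

lemma central_mult:
  fixes y z :: "'a::division_ring"
  assumes y: "\<And>x. y * x = x * y" and z: "\<And>x. z * x = x * z"
  shows "y * z * x = x * (y * z)"
proof -
  have "y * z * x = y * (x * z)"
    by (simp only: mult.assoc z[of x])
  also have "\<dots> = x * y * z"
    by (simp only: mult.assoc[symmetric] y[of x])
  finally show ?thesis
    by (simp only: mult.assoc)
qed

instantiation centre :: (division_ring) "{zero, one, plus, minus, uminus, times, inverse}"
begin

lift_definition zero_centre :: "'a centre" is 0 by simp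
lift_definition one_centre :: "'a centre" is 1 by simp
lift_definition plus_centre :: "'a centre \<Rightarrow> 'a centre \<Rightarrow> 'a centre" is "(+)"
  by (simp add: algebra_simps)
lift_definition minus_centre :: "'a centre \<Rightarrow> 'a centre \<Rightarrow> 'a centre" is "(-)"
  by (simp add: algebra_simps)
lift_definition uminus_centre :: "'a centre \<Rightarrow> 'a centre" is uminus
  by simp
lift_definition times_centre :: "'a centre \<Rightarrow> 'a centre \<Rightarrow> 'a centre" is "(*)"
  by (rule central_mult)
lift_definition inverse_centre :: "'a centre \<Rightarrow> 'a centre" is inverse
  by (rule central_inverse)
lift_definition divide_centre :: "'a centre \<Rightarrow> 'a centre \<Rightarrow> 'a centre" is "(/)"
  unfolding divide_inverse by (intro central_mult central_inverse)

instance ..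

end

instance centre :: (division_ring) field
proof
  fix a b c :: "'a centre"
  note reps = of_centre_inject[symmetric] zero_centre.rep_eq one_centre.rep_eq plus_centre.rep_eq
    minus_centre.rep_eq uminus_centre.rep_eq times_centre.rep_eq inverse_centre.rep_eq
    divide_centre.rep_eq
  show "a * b * c = a * (b * c)" "1 * a = a" "a + b + c = a + (b + c)" "a + b = b + a" "0 + a = a"
    "- a + a = 0" "a - b = a + - b" "(a + b) * c = a * c + b * c" "(0 :: 'a centre) \<noteq> 1"
    "a \<noteq> 0 \<Longrightarrow> inverse a * a = 1" "inverse (0 :: 'a centre) = 0" "a / b = a * inverse b"
    by (simp_all add: reps mult.assoc add.assoc add.commute distrib_right divide_inverse)
  show "a * b = b * a"
    unfolding reps by (rule of_centre_commute)
qed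

definition centre_scale :: "'a::division_ring centre \<Rightarrow> 'a \<Rightarrow> 'a"
  where "centre_scale c x = of_centre c * x"

global_interpretation over_centre: vector_space "centre_scale :: 'a::division_ring centre \<Rightarrow> 'a \<Rightarrow> 'a"
  by standard
    (simp_all add: centre_scale_def distrib_left distrib_right mult.assoc
      plus_centre.rep_eq times_centre.rep_eq one_centre.rep_eq)

text \<open>
  The library's \<^locale>\<open>vector_space\<close> needs commuting scalars, so right vector spaces over a
  division ring are introduced here.  Linear independence, span and basis are notions for
  families \<open>v\<close> indexed by a set \<open>I\<close>.
\<close>

locale right_vector_space =
  fixes scale :: "'v::ab_group_add \<Rightarrow> 'k::division_ring \<Rightarrow> 'v" (infixl \<open>\<star>\<close> 75)
  assumes scale_add_left: "(x + y) \<star> b = x \<star> b + y \<star> b"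
    and scale_add_right: "x \<star> (b + c) = x \<star> b + x \<star> c"
    and scale_scale: "x \<star> b \<star> c = x \<star> (b * c)"
    and scale_one: "x \<star> 1 = x"
begin

definition subspace :: "'v set \<Rightarrow> bool"
  where "subspace V \<longleftrightarrow> 0 \<in> V \<and> (\<forall>x\<in>V. \<forall>y\<in>V. x + y \<in> V) \<and> (\<forall>x\<in>V. \<forall>b. x \<star> b \<in> V)"

definition span :: "'i set \<Rightarrow> ('i \<Rightarrow> 'v) \<Rightarrow> 'v set"
  where "span I v = {(\<Sum>i\<in>J. v i \<star> b i) | J b. finite J \<and> J \<subseteq> I}"

definition independent :: "'i set \<Rightarrow> ('i \<Rightarrow> 'v) \<Rightarrow> bool"
  where "independent I v \<longleftrightarrow>
    (\<forall>J b. finite J \<and> J \<subseteq> I \<and> (\<Sum>i\<in>J. v i \<star> b i) = 0 \<longrightarrow> (\<forall>i\<in>J. b i = 0))"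

definition basis :: "'v set \<Rightarrow> 'i set \<Rightarrow> ('i \<Rightarrow> 'v) \<Rightarrow> bool"
  where "basis V I v \<longleftrightarrow> subspace V \<and> independent I v \<and> span I v = V"

end

definition End_centre :: "('a::division_ring \<Rightarrow> 'a) set"
  where "End_centre = {f. Vector_Spaces.linear centre_scale centre_scale f}"

definition right_scale :: "('a::division_ring \<Rightarrow> 'a) \<Rightarrow> 'a \<Rightarrow> 'a \<Rightarrow> 'a"
  where "right_scale f b = (\<lambda>x. f x * b)"

global_interpretation right: right_vector_space "right_scale :: ('a::division_ring \<Rightarrow> 'a) \<Rightarrow> 'a \<Rightarrow> 'a \<Rightarrow> 'a"
  by standard (simp_all add: right_scale_def fun_eq_iff distrib_left distrib_right mult.assoc)

definition left_mult :: "'a::division_ring \<Rightarrow> 'a \<Rightarrow> 'a"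
  where "left_mult a = (\<lambda>x. a * x)"

lemma mem_End_centre_iff:
  "f \<in> End_centre \<longleftrightarrow> (\<forall>x y. f (x + y) = f x + f y) \<and> (\<forall>c x. f (of_centre c * x) = of_centre c * f x)"
  by (auto simp: End_centre_def Vector_Spaces.linear_iff over_centre.vector_space_axioms centre_scale_def)

lemma subspace_End_centre: "right.subspace End_centre"
  by (auto simp: right.subspace_def mem_End_centre_iff right_scale_def algebra_simps)

lemma left_mult_in_End_centre: "left_mult a \<in> End_centre"
  by (simp add: mem_End_centre_iff left_mult_def distrib_left) (metis mult.assoc of_centre_commute)

text \<open>
  The library's \<open>over_centre.dim V\<close> is the dimension of the span of \<open>V\<close>; the following two facts
  show that for the sets of interest this is the dimension of \<open>V\<close> itself.
\<close>

lemma subspace_subfield: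
  assumes "subfield L" "range of_centre \<subseteq> L"
  shows "over_centre.subspace L"
  using assms by (auto simp: over_centre.subspace_def subfield_def centre_scale_def)

lemma subspace_commutant: "over_centre.subspace (commutant L)"
  by (auto simp: over_centre.subspace_def commutant_def centre_scale_def distrib_left distrib_right)
    (metis mult.assoc of_centre_commute)

end

theory Submission
  imports Defs
begin

text \<open>
  Write \<open>K\<close> for the division ring, \<open>k\<close> for its centre and \<open>A\<close> for a \<open>k\<close>-basis of \<open>K\<close> with \<open>d\<close> elements.

  The heart of the matter is that a relation \<open>\<Sum> s x b\<^sub>s = 0\<close>, valid for all \<open>x\<close>, with left factors \<open>s\<close>
  independent over \<open>k\<close>, must be trivial (\<open>independent_left_factors\<close>).  Replacing \<open>x\<close> by \<open>x y\<close> and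
  multiplying by \<open>y\<close> on the right yield two relations whose difference has the coefficients
  \<open>y b\<^sub>s - b\<^sub>s y\<close>.  If one \<open>b\<^sub>s\<close> is normalised to \<open>1\<close>, that difference is shorter; induction
  makes all the \<open>b\<^sub>s\<close> central, and at \<open>x = 1\<close> the relation contradicts independence over \<open>k\<close>.
  Thus the left multiplications by elements of \<open>A\<close> are independent over \<open>K\<close>.  An element of
  \<open>End\<^sub>k(K)\<close> is determined by its \<open>d\<close> values on \<open>A\<close>, so any \<open>d + 1\<close> such maps satisfy a nontrivial
  \<open>K\<close>-linear relation; hence the left multiplications also span (\<open>End_centre_left_form\<close>).

  For the dimension formula let \<open>X\<close> be a basis of \<open>K\<close> as a left \<open>L\<close>-space, so that
  \<open>d = |X| dim L\<close> (\<open>dim_UNIV_tower\<close>), and consider the right \<open>K\<close>-space \<open>E\<close> of the left \<open>L\<close>-linear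
  maps \<open>K \<rightarrow> K\<close>.  On one hand such a map is freely determined by its values on \<open>X\<close>, so \<open>E\<close> has
  dimension \<open>|X|\<close>.  On the other hand the left multiplications by a \<open>k\<close>-basis of the commutant of \<open>L\<close>
  form a basis of \<open>E\<close>: they are independent as before, and they span because a \<open>k\<close>-linear map can also
  be written as \<open>x \<mapsto> \<Sum> g\<^sub>t x t\<close> with \<open>t\<close> running over \<open>A\<close>, where by uniqueness of the \<open>g\<^sub>t\<close> the map is
  \<open>L\<close>-linear only if every \<open>g\<^sub>t\<close> commutes with \<open>L\<close> (\<open>subfield_linear_map_form\<close>).  Comparing the two,
  \<open>dim C(L) = |X|\<close> (\<open>dim_commutant_eq_card_left_basis\<close>).

  A maximal commutative subfield is its own commutant (\<open>commutant_maximal_commutative_subfield\<close>), and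
  the formula becomes \<open>d = n\<^sup>2\<close>.
\<close>

section \<open>Homogeneous linear systems over a division ring\<close>

text \<open>
  Gaussian elimination with the unknowns on the right of the coefficients.  It takes the place of
  dimension theory over a division ring: all comparisons of dimensions of right \<open>K\<close>-spaces below are
  instances of it.
\<close>

lemma homogeneous_system_nontrivial_solution:
  fixes M :: "'j \<Rightarrow> 'i \<Rightarrow> 'k::division_ring"
  assumes "finite J" "finite I" "card J < card I"
  obtains b where "\<exists>i\<in>I. b i \<noteq> 0" "\<And>j. j \<in> J \<Longrightarrow> (\<Sum>i\<in>I. M j i * b i) = 0"
proof -
  have "\<exists>b. (\<exists>i\<in>I. b i \<noteq> 0) \<and> (\<forall>j\<in>J. (\<Sum>i\<in>I. M j i * b i) = 0)"
    using assms
  proof (induction J arbitrary: I M rule: finite_induct)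
    case empty
    then have "I \<noteq> {}" by auto
    then show ?case by (intro exI[of _ "\<lambda>_. 1"]) auto
  next
    case (insert p J)
    show ?case
    proof (cases "\<forall>i\<in>I. M p i = 0")
      case True
      moreover have "card J < card I" using insert by simp
      ultimately show ?thesis using insert.IH[of I M] insert.prems by auto
    next
      case False
      then obtain q where q: "q \<in> I" "M p q \<noteq> 0" by blast
      let ?I = "I - {q}"
      \<comment> \<open>Row \<open>p\<close> is solved for the unknown \<open>q\<close>, which is then eliminated from the other rows.\<close>
      define N where "N j i = M j i - M j q * inverse (M p q) * M p i" for j i
      have "card J < card ?I" using insert q by simp
      then obtain b where nz: "\<exists>i\<in>?I. b i \<noteq> 0" and b: "\<forall>j\<in>J. (\<Sum>i\<in>?I. N j i * b i) = 0"
        using insert.IH[of ?I N] insert.prems by auto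
      define s where "s = (\<Sum>i\<in>?I. M p i * b i)"
      define b' where "b' = b(q := - inverse (M p q) * s)"
      have split: "(\<Sum>i\<in>I. M j i * b' i) = (\<Sum>i\<in>?I. M j i * b i) - M j q * inverse (M p q) * s" for j
      proof -
        have "(\<Sum>i\<in>?I. M j i * b' i) = (\<Sum>i\<in>?I. M j i * b i)"
          by (rule sum.cong) (auto simp: b'_def)
        then show ?thesis
          using insert.prems q by (simp add: sum.remove[of I q] b'_def mult.assoc)
      qed
      have "(\<Sum>i\<in>I. M j i * b' i) = 0" if j: "j \<in> insert p J" for j
      proof (cases "j = p")
        case True
        then show ?thesis using q by (simp add: split) (simp add: s_def)
      next
        case False
        then have "(\<Sum>i\<in>?I. N j i * b i) = 0" using b j by simp
        then show ?thesis
          by (simp add: split s_def N_def sum_distrib_left sum_subtractf left_diff_distrib mult.assoc)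
      qed
      moreover have "\<exists>i\<in>I. b' i \<noteq> 0" using nz by (auto simp: b'_def)
      ultimately show ?thesis by blast
    qed
  qed
  then show ?thesis using that by blast
qed

section \<open>Linear combinations over the centre and over a subfield\<close>

text \<open>
  The scalars form a subset \<open>L\<close> of the ring rather than a type, because \<open>L\<close> is later an arbitrary
  subfield and need not be commutative.
\<close>

definition left_independent :: "'a::division_ring set \<Rightarrow> 'a set \<Rightarrow> bool"
  where "left_independent L X \<longleftrightarrow>
    (\<forall>u. (\<forall>x\<in>X. u x \<in> L) \<and> (\<Sum>x\<in>X. u x * x) = 0 \<longrightarrow> (\<forall>x\<in>X. u x = 0))"

definition left_basis :: "'a::division_ring set \<Rightarrow> 'a set \<Rightarrow> bool"
  where "left_basis L X \<longleftrightarrow> finite X \<and> left_independent L X \<and>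
    (\<forall>y. \<exists>u. (\<forall>x\<in>X. u x \<in> L) \<and> y = (\<Sum>x\<in>X. u x * x))"

lemma of_centre_eq_0_iff: "of_centre z = 0 \<longleftrightarrow> z = 0"
  by (metis of_centre_inject zero_centre.rep_eq)

lemma independent_centre_coeffs:
  assumes "finite A" "over_centre.independent A" "(\<Sum>s\<in>A. of_centre (z s) * s) = 0" "s \<in> A"
  shows "z s = 0"
  using over_centre.independentD[OF assms(2,1) subset_refl _ assms(4), of z] assms(3)
  by (simp add: centre_scale_def)

lemma span_centre_coeffs:
  assumes "finite A" "x \<in> over_centre.span A"
  obtains z where "x = (\<Sum>s\<in>A. of_centre (z s) * s)"
  using assms that by (auto simp: over_centre.span_finite centre_scale_def)

lemma left_independent_imp_independent:
  assumes "finite X" "range of_centre \<subseteq> L" "left_independent L X"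
  shows "over_centre.independent X"
proof
  assume "over_centre.dependent X"
  then obtain z where z: "\<exists>x\<in>X. z x \<noteq> 0" "(\<Sum>x\<in>X. of_centre (z x) * x) = 0"
    using over_centre.dependent_finite[OF assms(1)] by (auto simp: centre_scale_def)
  then have "\<forall>x\<in>X. of_centre (z x) = 0"
    using assms(2,3) unfolding left_independent_def by (auto dest!: spec[of _ "\<lambda>x. of_centre (z x)"])
  then show False using z(1) by (simp add: of_centre_eq_0_iff)
qed

text \<open>
  Indexed families are the natural form for a basis of products \<open>b x\<close>; injectivity of the family is
  itself a consequence of independence, since \<open>v p = v q\<close> is a linear relation.
\<close>

lemma dim_UNIV_eq_card_family:
  fixes v :: "'i \<Rightarrow> 'a::division_ring"
  assumes fin: "finite I"
    and indep: "\<And>z :: 'i \<Rightarrow> 'a centre. (\<Sum>i\<in>I. of_centre (z i) * v i) = 0 \<Longrightarrow> \<forall>i\<in>I. z i = 0"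
    and span: "\<And>x. \<exists>z :: 'i \<Rightarrow> 'a centre. x = (\<Sum>i\<in>I. of_centre (z i) * v i)"
  shows "over_centre.dim (UNIV :: 'a set) = card I"
proof -
  have inj: "inj_on v I"
  proof (rule inj_onI, rule ccontr)
    fix p q assume pq: "p \<in> I" "q \<in> I" "v p = v q" "p \<noteq> q"
    define z :: "'i \<Rightarrow> 'a centre" where "z i = (if i = p then 1 else if i = q then - 1 else 0)" for i
    have "(\<Sum>i\<in>I. of_centre (z i) * v i) = (\<Sum>i\<in>{p,q}. of_centre (z i) * v i)"
      by (rule sum.mono_neutral_right) (use fin pq in \<open>auto simp: z_def zero_centre.rep_eq\<close>)
    also have "\<dots> = 0"
      using pq by (simp add: z_def uminus_centre.rep_eq one_centre.rep_eq)
    finally have "z p = 0" using indep pq(1) by blast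
    then show False by (simp add: z_def)
  qed
  have "over_centre.independent (v ` I)"
  proof
    assume "over_centre.dependent (v ` I)"
    then obtain z where z: "\<exists>i\<in>I. z (v i) \<noteq> 0" "(\<Sum>x\<in>v ` I. of_centre (z x) * x) = 0"
      using over_centre.dependent_finite[of "v ` I"] fin by (auto simp: centre_scale_def)
    then have "(\<Sum>i\<in>I. of_centre (z (v i)) * v i) = 0" by (simp add: sum.reindex[OF inj])
    then show False using indep[of "z \<circ> v"] z(1) by auto
  qed
  moreover have "over_centre.span (v ` I) = UNIV"
  proof (intro UNIV_eq_I[symmetric])
    fix x
    obtain z :: "'i \<Rightarrow> 'a centre" where "x = (\<Sum>i\<in>I. of_centre (z i) * v i)" using span by blast
    then have "x = (\<Sum>i\<in>I. centre_scale (z i) (v i))" by (simp add: centre_scale_def)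
    then show "x \<in> over_centre.span (v ` I)"
      by (auto intro!: over_centre.span_sum over_centre.span_scale intro: over_centre.span_base)
  qed
  ultimately have "over_centre.dim (UNIV :: 'a set) = card (v ` I)"
    by (intro over_centre.dim_eq_card) simp_all
  then show ?thesis by (simp add: card_image[OF inj])
qed

section \<open>Two-sided multiplication maps\<close>

text \<open>
  The commutator trick: from the relations for \<open>x y\<close> and for \<open>x\<close> one obtains the relation with
  coefficients \<open>y c\<^sub>s - c\<^sub>s y\<close>, in which the term with \<open>c\<^sub>p = 1\<close> has disappeared.  Shorter
  relations being trivial, the \<open>c\<^sub>s\<close> are central, and \<open>x = 1\<close> gives a relation over the centre.
\<close>

lemma independent_left_factors:
  fixes B :: "'a::division_ring set"
  assumes "finite B" "over_centre.independent B"
    and "\<And>x. (\<Sum>s\<in>B. s * x * b s) = 0" "s \<in> B"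
  shows "b s = 0"
proof -
  have "\<forall>s\<in>B. b s = 0" using assms(1-3)
  proof (induction B arbitrary: b rule: finite_induct)
    case (insert p B)
    have indB: "over_centre.independent B"
      using insert.prems(1) over_centre.independent_mono by blast
    have bp: "b p = 0"
    proof (rule ccontr)
      assume nz: "b p \<noteq> 0"
      define c where "c s = b s * inverse (b p)" for s
      have cp: "c p = 1" using nz by (simp add: c_def)
      have rel: "p * x + (\<Sum>s\<in>B. s * x * c s) = 0" for x
      proof -
        have "(\<Sum>s\<in>insert p B. s * x * b s) * inverse (b p) = 0"
          by (simp only: insert.prems(2)) simp
        then show ?thesis
          using insert.hyps nz by (simp add: distrib_right sum_distrib_right c_def mult.assoc)
      qed
      have comm: "y * c s = c s * y" if "s \<in> B" for s y
      proof -
        have "(\<Sum>s\<in>B. s * x * (y * c s - c s * y)) = 0" for x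
        proof -
          have "(\<Sum>s\<in>B. s * x * (y * c s - c s * y)) =
              (p * (x * y) + (\<Sum>s\<in>B. s * (x * y) * c s)) - (p * x + (\<Sum>s\<in>B. s * x * c s)) * y"
            by (simp add: right_diff_distrib distrib_right sum_subtractf sum_distrib_right mult.assoc)
          then show ?thesis by (simp only: rel) simp
        qed
        then have "y * c s - c s * y = 0" 
          using insert.IH[OF indB, of "\<lambda>s. y * c s - c s * y"] that by blast
        then show ?thesis by simp
      qed
      \<comment> \<open>The coefficients commute with everything, so they lie in the centre and can be lifted to the type of central scalars.\<close>
      have "\<forall>s. \<exists>z. s \<in> insert p B \<longrightarrow> c s = of_centre z"
      proof
        fix s
        have "c s \<in> range of_centre" if "s \<in> insert p B"
          using that comm cp by (auto simp: range_of_centre)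
        then show "\<exists>z. s \<in> insert p B \<longrightarrow> c s = of_centre z" by auto
      qed
      then obtain z where z: "\<And>s. s \<in> insert p B \<Longrightarrow> c s = of_centre (z s)" by metis
      have "(\<Sum>s\<in>insert p B. of_centre (z s) * s) = (\<Sum>s\<in>insert p B. s * 1 * c s)"
        by (rule sum.cong) (simp_all add: z of_centre_commute)
      also have "\<dots> = 0" using rel[of 1] insert.hyps cp by simp
      finally have "z p = 0"
        using independent_centre_coeffs[OF _ insert.prems(1)] insert.hyps(1) by blast
      then show False using z[of p] cp by (simp add: zero_centre.rep_eq)
    qed
    moreover have "\<forall>s\<in>B. b s = 0"
      using insert.IH[OF indB, of b] insert.prems(2) insert.hyps bp by simp
    ultimately show ?case by simp
  qed simp
  then show ?thesis using assms(4) by blast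
qed

lemma sum_right_scale_left_mult:
  assumes "finite J"
  shows "(\<Sum>i\<in>J. right_scale (left_mult (v i)) (b i)) = (\<lambda>x. \<Sum>i\<in>J. v i * x * b i)"
  using assms
  by (induction J rule: finite_induct) (auto simp: right_scale_def left_mult_def fun_eq_iff)

lemma independent_left_mult:
  fixes v :: "'i \<Rightarrow> 'a::division_ring"
  assumes inj: "inj_on v I" and indep: "over_centre.independent (v ` I)"
  shows "right.independent I (\<lambda>i. left_mult (v i))"
  unfolding right.independent_def
proof (intro allI impI ballI, elim conjE)
  fix J b j
  assume J: "finite J" "J \<subseteq> I" and zero: "(\<Sum>i\<in>J. right_scale (left_mult (v i)) (b i)) = 0"
    and j: "j \<in> J"
  have injJ: "inj_on v J" using inj J inj_on_subset by blast
  let ?b = "\<lambda>s. b (inv_into J v s)"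
  have "(\<Sum>s\<in>v ` J. s * x * ?b s) = 0" for x
  proof -
    have "(\<Sum>s\<in>v ` J. s * x * ?b s) = (\<Sum>i\<in>J. v i * x * b i)"
      by (simp add: sum.reindex[OF injJ] injJ)
    then show ?thesis using zero J(1) by (simp add: sum_right_scale_left_mult fun_eq_iff)
  qed
  moreover have "over_centre.independent (v ` J)"
    using indep J(2) by (meson image_mono over_centre.independent_mono)
  ultimately have "?b (v j) = 0"
    using independent_left_factors[of "v ` J" ?b "v j"] J(1) j by blast
  then show "b j = 0" using injJ j by simp
qed

lemma sum_left_mult_in_End_centre:
  fixes v b :: "'i \<Rightarrow> 'a::division_ring"
  shows "(\<lambda>x. \<Sum>i\<in>J. v i * x * b i) \<in> End_centre"
proof -
  have "s * (of_centre c * x) * y = of_centre c * (s * x * y)" for s x y :: 'a and c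
    by (metis mult.assoc of_centre_commute)
  then have "(\<Sum>i\<in>J. v i * (of_centre c * x) * b i) = of_centre c * (\<Sum>i\<in>J. v i * x * b i)" for c x
    unfolding sum_distrib_left by (intro sum.cong refl)
  then show ?thesis
    by (simp add: mem_End_centre_iff distrib_left distrib_right sum.distrib)
qed

context
  fixes A :: "'a::division_ring set"
  assumes finA: "finite A" and indA: "over_centre.independent A"
    and spanA: "over_centre.span A = UNIV"
begin

lemma basis_coeffs: "\<exists>z :: 'i \<Rightarrow> 'a \<Rightarrow> 'a centre. \<forall>i. h i = (\<Sum>s\<in>A. of_centre (z i s) * s)"
proof -
  have "\<forall>i. \<exists>z. h i = (\<Sum>s\<in>A. of_centre (z s) * s)"
    using span_centre_coeffs[OF finA] spanA by (metis UNIV_I)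
  then show ?thesis by (rule choice)
qed

text \<open>
  The mirror image of \<open>independent_left_factors\<close>, obtained by expanding the unknown left factors in
  the basis: \<open>\<Sum>\<^sub>t h\<^sub>t x t = \<Sum>\<^sub>s s x (\<Sum>\<^sub>t z\<^sub>t\<^sub>s t)\<close> when \<open>h\<^sub>t = \<Sum>\<^sub>s z\<^sub>t\<^sub>s s\<close> with central \<open>z\<^sub>t\<^sub>s\<close>.
\<close>

lemma independent_right_factors:
  assumes "\<And>x. (\<Sum>t\<in>A. h t * x * t) = 0" "t \<in> A"
  shows "h t = 0"
proof -
  obtain z :: "'a \<Rightarrow> 'a \<Rightarrow> 'a centre" where z: "\<And>t. h t = (\<Sum>s\<in>A. of_centre (z t s) * s)"
    using basis_coeffs[of h] by blast
  have zero: "(\<Sum>t\<in>A. of_centre (z t s) * t) = 0" if s: "s \<in> A" for s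
  proof (rule independent_left_factors[OF finA indA _ s])
    fix x
    have "(\<Sum>s\<in>A. s * x * (\<Sum>t\<in>A. of_centre (z t s) * t)) =
        (\<Sum>s\<in>A. \<Sum>t\<in>A. s * x * (of_centre (z t s) * t))"
      by (simp add: sum_distrib_left)
    also have "\<dots> = (\<Sum>t\<in>A. \<Sum>s\<in>A. s * x * (of_centre (z t s) * t))"
      by (rule sum.swap)
    also have "\<dots> = (\<Sum>t\<in>A. h t * x * t)"
      unfolding z sum_distrib_right
      by (intro sum.cong refl) (metis mult.assoc of_centre_commute)
    finally show "(\<Sum>s\<in>A. s * x * (\<Sum>t\<in>A. of_centre (z t s) * t)) = 0" using assms(1) by simp
  qed
  have "z t s = 0" if "s \<in> A" for s
    using independent_centre_coeffs[OF finA indA zero[OF that] assms(2)] .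
  then show ?thesis by (simp add: z zero_centre.rep_eq)
qed

lemma End_centre_eqI:
  fixes f g :: "'a \<Rightarrow> 'a"
  assumes f: "f \<in> End_centre" and g: "g \<in> End_centre" and eq: "\<And>s. s \<in> A \<Longrightarrow> f s = g s"
  shows "f = g"
proof
  fix x
  interpret vector_space_pair "centre_scale :: 'a centre \<Rightarrow> 'a \<Rightarrow> 'a" "centre_scale :: 'a centre \<Rightarrow> 'a \<Rightarrow> 'a"
    by unfold_locales
  show "f x = g x"
    by (rule linear_eq_on[where B = A]) (use f g eq spanA in \<open>simp_all add: End_centre_def\<close>)
qed

text \<open>
  A count of equations: \<open>f\<close> and the left multiplications by the elements of \<open>A\<close> are \<open>|A| + 1\<close>
  maps, and a relation between them need only be imposed at the \<open>|A|\<close> points of \<open>A\<close>.  Its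
  coefficient at \<open>f\<close> cannot vanish, as the left multiplications are independent.
\<close>

lemma End_centre_left_form:
  fixes f :: "'a \<Rightarrow> 'a"
  assumes f: "f \<in> End_centre"
  obtains b where "\<And>x. f x = (\<Sum>s\<in>A. s * x * b s)"
proof -
  \<comment> \<open>The unknown indexed by \<open>None\<close> is the coefficient of \<open>f\<close>.\<close>
  define M where "M x i = (case i of None \<Rightarrow> f x | Some s \<Rightarrow> s * x)" for x i
  have "card A < card (insert None (Some ` A))"
    using finA by (simp add: card_image)
  then obtain b where nz: "\<exists>i\<in>insert None (Some ` A). b i \<noteq> 0"
    and b: "\<And>x. x \<in> A \<Longrightarrow> (\<Sum>i\<in>insert None (Some ` A). M x i * b i) = 0"
    using homogeneous_system_nontrivial_solution[of A "insert None (Some ` A)" M] finA by auto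
  have rel: "f x * b None = - (\<Sum>s\<in>A. s * x * b (Some s))" for x
  proof -
    have "(\<lambda>x. f x * b None) = (\<lambda>x. \<Sum>s\<in>A. s * x * - b (Some s))"
    proof (rule End_centre_eqI)
      show "(\<lambda>x. f x * b None) \<in> End_centre"
        using subspace_End_centre f unfolding right.subspace_def right_scale_def by blast
      show "(\<lambda>x. \<Sum>s\<in>A. s * x * - b (Some s)) \<in> End_centre"
        by (rule sum_left_mult_in_End_centre)
      show "f x * b None = (\<Sum>s\<in>A. s * x * - b (Some s))" if "x \<in> A" for x
        using b[OF that] finA by (simp add: M_def sum.reindex sum_negf eq_neg_iff_add_eq_0)
    qed
    then show ?thesis by (simp add: fun_eq_iff sum_negf)
  qed
  have bN: "b None \<noteq> 0"
  proof
    assume 0: "b None = 0"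
    then have "(\<Sum>s\<in>A. s * x * b (Some s)) = 0" for x using rel[of x] by simp
    then have "\<forall>s\<in>A. b (Some s) = 0"
      using independent_left_factors[OF finA indA, of "\<lambda>s. b (Some s)"] by blast
    then show False using nz 0 by auto
  qed
  have "f x = (\<Sum>s\<in>A. s * x * (- b (Some s) * inverse (b None)))" for x
  proof -
    have "f x = f x * b None * inverse (b None)" using bN by (simp add: mult.assoc)
    then show ?thesis
      unfolding rel by (simp add: sum_distrib_right sum_negf mult.assoc)
  qed
  then show ?thesis by (rule that)
qed

text \<open>
  Expanding the right factors of the left form in the basis and moving the central coefficients to
  the left turns one form into the other.
\<close>

lemma End_centre_right_form:
  fixes f :: "'a \<Rightarrow> 'a"
  assumes "f \<in> End_centre"
  obtains g where "\<And>x. f x = (\<Sum>t\<in>A. g t * x * t)"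
proof -
  obtain b where b: "\<And>x. f x = (\<Sum>s\<in>A. s * x * b s)"
    using End_centre_left_form[OF assms] by blast
  obtain z :: "'a \<Rightarrow> 'a \<Rightarrow> 'a centre" where z: "\<And>s. b s = (\<Sum>t\<in>A. of_centre (z s t) * t)"
    using basis_coeffs[of b] by blast
  have "f x = (\<Sum>t\<in>A. (\<Sum>s\<in>A. of_centre (z s t) * s) * x * t)" for x
  proof -
    have "f x = (\<Sum>s\<in>A. \<Sum>t\<in>A. s * x * (of_centre (z s t) * t))"
      by (simp add: b z sum_distrib_left)
    also have "\<dots> = (\<Sum>t\<in>A. \<Sum>s\<in>A. s * x * (of_centre (z s t) * t))"
      by (rule sum.swap)
    also have "\<dots> = (\<Sum>t\<in>A. (\<Sum>s\<in>A. of_centre (z s t) * s) * x * t)"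
      unfolding sum_distrib_right
      by (intro sum.cong refl) (metis mult.assoc of_centre_commute)
    finally show ?thesis .
  qed
  then show ?thesis by (rule that)
qed

section \<open>The commutant of a subfield\<close>

text \<open>
  If \<open>f x = \<Sum> g\<^sub>t x t\<close>, then \<open>f (l x) - l f x = \<Sum> (g\<^sub>t l - l g\<^sub>t) x t\<close>.  This vanishes for
  all \<open>x\<close> only if each \<open>g\<^sub>t\<close> commutes with \<open>l\<close>, so the \<open>g\<^sub>t\<close> can be expanded in a spanning set of
  the commutant.
\<close>

lemma subfield_linear_map_form:
  fixes f :: "'a \<Rightarrow> 'a"
  assumes f: "f \<in> End_centre" and lin: "\<And>l x. l \<in> L \<Longrightarrow> f (l * x) = l * f x"
    and C: "finite C" "commutant L \<subseteq> over_centre.span C"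
  obtains b where "\<And>x. f x = (\<Sum>c\<in>C. c * x * b c)"
proof -
  obtain g where g: "\<And>x. f x = (\<Sum>t\<in>A. g t * x * t)"
    using End_centre_right_form[OF f] by blast
  have gC: "g t \<in> commutant L" if t: "t \<in> A" for t
  proof -
    have "g t * l = l * g t" if l: "l \<in> L" for l
    proof -
      have "(\<Sum>t\<in>A. (g t * l - l * g t) * x * t) = 0" for x
      proof -
        have "(\<Sum>t\<in>A. (g t * l - l * g t) * x * t) = f (l * x) - l * f x"
          by (simp add: g left_diff_distrib sum_subtractf sum_distrib_left mult.assoc)
        then show ?thesis using lin[OF l] by simp
      qed
      then have "g t * l - l * g t = 0" using independent_right_factors[of "\<lambda>t. g t * l - l * g t"] t by blast
      then show ?thesis by simp
    qed
    then show ?thesis by (simp add: commutant_def)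
  qed
  have "\<forall>t. \<exists>z. t \<in> A \<longrightarrow> g t = (\<Sum>c\<in>C. of_centre (z c) * c)"
    using gC C span_centre_coeffs[OF C(1)] by (metis subset_iff)
  then obtain z where z: "\<And>t. t \<in> A \<Longrightarrow> g t = (\<Sum>c\<in>C. of_centre (z t c) * c)" by metis
  have "f x = (\<Sum>c\<in>C. c * x * (\<Sum>t\<in>A. of_centre (z t c) * t))" for x
  proof -
    have "f x = (\<Sum>t\<in>A. \<Sum>c\<in>C. of_centre (z t c) * c * x * t)"
      by (simp add: g z sum_distrib_right)
    also have "\<dots> = (\<Sum>c\<in>C. \<Sum>t\<in>A. of_centre (z t c) * c * x * t)"
      by (rule sum.swap)
    also have "\<dots> = (\<Sum>c\<in>C. c * x * (\<Sum>t\<in>A. of_centre (z t c) * t))"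
      unfolding sum_distrib_left
      by (intro sum.cong refl) (metis mult.assoc of_centre_commute)
    finally show ?thesis .
  qed
  then show ?thesis by (rule that)
qed

text \<open>
  Independence over \<open>L\<close> implies independence over the centre, which bounds the size of an
  \<open>L\<close>-independent set; one of largest size spans, by the usual exchange argument.
\<close>

lemma exists_left_basis:
  fixes L :: "'a set"
  assumes L: "subfield L" "range of_centre \<subseteq> L"
  obtains X where "left_basis L X"
proof -
  let ?P = "\<lambda>X. finite X \<and> left_independent L X"
  have "?P {}" by (simp add: left_independent_def)
  moreover have "\<forall>X. ?P X \<longrightarrow> card X < Suc (card A)"
    using left_independent_imp_independent[OF _ L(2)] over_centre.independent_span_bound[OF finA]
    by (simp add: spanA less_Suc_eq_le)
  ultimately obtain X where X: "?P X" and max: "\<And>Y. ?P Y \<Longrightarrow> card Y \<le> card X"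
    using Lattices_Big.ex_has_greatest_nat[of ?P "{}" card "Suc (card A)"] by blast
  have mult: "\<And>x y. x \<in> L \<Longrightarrow> y \<in> L \<Longrightarrow> x * y \<in> L" and inv: "\<And>x. x \<in> L \<Longrightarrow> - inverse x \<in> L"
    using L(1) by (simp_all add: subfield_def)
  have "\<exists>u. (\<forall>x\<in>X. u x \<in> L) \<and> y = (\<Sum>x\<in>X. u x * x)" for y
  proof (cases "y \<in> X")
    case True
    then have "y = (\<Sum>x\<in>X. (if x = y then 1 else 0) * x)"
      using X by (simp add: if_distrib[of "\<lambda>t. t * _"] sum.delta cong: if_cong)
    then show ?thesis
      using L(1) by (intro exI[of _ "\<lambda>x. if x = y then 1 else 0"]) (auto simp: subfield_def)
  next
    case False
    then have "\<not> ?P (insert y X)" using max[of "insert y X"] X by auto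
    then obtain u where u: "\<forall>x\<in>insert y X. u x \<in> L" "u y * y + (\<Sum>x\<in>X. u x * x) = 0"
      "\<exists>x\<in>insert y X. u x \<noteq> 0"
      using X False by (auto simp: left_independent_def)
    have uy: "u y \<noteq> 0"
    proof
      assume "u y = 0"
      then have "\<forall>x\<in>X. u x = 0" using u X by (simp add: left_independent_def)
      then show False using u(3) \<open>u y = 0\<close> by simp
    qed
    have "y = inverse (u y) * (u y * y)" using uy by (simp flip: mult.assoc)
    also have "u y * y = - (\<Sum>x\<in>X. u x * x)" using u(2) by (simp add: eq_neg_iff_add_eq_0)
    finally have "y = (\<Sum>x\<in>X. - inverse (u y) * u x * x)"
      by (simp add: sum_distrib_left sum_negf mult.assoc)
    then show ?thesis
      using u(1) mult[OF inv] by (intro exI[of _ "\<lambda>x. - inverse (u y) * u x"]) blast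
  qed
  then show ?thesis using that X by (auto simp: left_basis_def)
qed

text \<open>
  The products \<open>b x\<close>, with \<open>b\<close> in a basis of \<open>L\<close> over the centre and \<open>x\<close> in \<open>X\<close>, form a basis of
  the whole ring over the centre.
\<close>

lemma dim_UNIV_tower:
  fixes L :: "'a set"
  assumes L: "subfield L" "range of_centre \<subseteq> L"
    and basis: "left_basis L X"
  shows "over_centre.dim (UNIV :: 'a set) = card X * over_centre.dim L"
proof -
  have X: "finite X" "left_independent L X"
    "\<And>y. \<exists>u. (\<forall>x\<in>X. u x \<in> L) \<and> y = (\<Sum>x\<in>X. u x * x)"
    using basis by (simp_all add: left_basis_def)
  obtain B where B: "B \<subseteq> L" "over_centre.independent B" "L \<subseteq> over_centre.span B"
    "card B = over_centre.dim L"
    using over_centre.basis_exists by blast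
  have finB: "finite B"
    using over_centre.independent_span_bound[OF finA B(2)] spanA by simp
  have subL: "over_centre.subspace L" by (rule subspace_subfield[OF L])
  have regroup: "(\<Sum>(x, b)\<in>X \<times> B. of_centre (z (x, b)) * (b * x)) =
      (\<Sum>x\<in>X. (\<Sum>b\<in>B. of_centre (z (x, b)) * b) * x)" for z
    by (simp add: sum.cartesian_product[symmetric] sum_distrib_right mult.assoc)
  have "over_centre.dim (UNIV :: 'a set) = card (X \<times> B)"
  proof (rule dim_UNIV_eq_card_family[where v = "\<lambda>(x, b). b * x"])
    fix z :: "'a \<times> 'a \<Rightarrow> 'a centre"
    assume "(\<Sum>i\<in>X \<times> B. of_centre (z i) * (case i of (x, b) \<Rightarrow> b * x)) = 0"
    then have "(\<Sum>x\<in>X. (\<Sum>b\<in>B. of_centre (z (x, b)) * b) * x) = 0"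
      by (simp add: regroup[symmetric] case_prod_unfold)
    moreover have "(\<Sum>b\<in>B. of_centre (z (x, b)) * b) \<in> L" for x
      unfolding centre_scale_def[symmetric]
      by (intro over_centre.subspace_sum[OF subL] over_centre.subspace_scale[OF subL]) (use B(1) in auto)
    ultimately have "\<forall>x\<in>X. (\<Sum>b\<in>B. of_centre (z (x, b)) * b) = 0"
      using X(2) unfolding left_independent_def
      by (auto dest!: spec[of _ "\<lambda>x. \<Sum>b\<in>B. of_centre (z (x, b)) * b"])
    then show "\<forall>i\<in>X \<times> B. z i = 0"
      using independent_centre_coeffs[OF finB B(2)] by fast
  next
    fix y
    obtain u where u: "\<forall>x\<in>X. u x \<in> L" "y = (\<Sum>x\<in>X. u x * x)" using X(3) by blast
    have "\<forall>x. \<exists>z. x \<in> X \<longrightarrow> u x = (\<Sum>b\<in>B. of_centre (z b) * b)"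
      using u(1) B(3) span_centre_coeffs[OF finB] by (metis subsetD)
    then obtain z where z: "\<And>x. x \<in> X \<Longrightarrow> u x = (\<Sum>b\<in>B. of_centre (z x b) * b)" by metis
    have "y = (\<Sum>(x, b)\<in>X \<times> B. of_centre (z x b) * (b * x))"
      using regroup[of "\<lambda>(x, b). z x b"] u(2) z by simp
    then show "\<exists>z :: 'a \<times> 'a \<Rightarrow> 'a centre. y = (\<Sum>i\<in>X \<times> B. of_centre (z i) * (case i of (x, b) \<Rightarrow> b * x))"
      by (intro exI[of _ "\<lambda>(x, b). z x b"]) (simp add: case_prod_unfold)
  qed (use X finB in simp)
  then show ?thesis using B(4) by (simp add: card_cartesian_product)
qed

text \<open>
  Both \<open>X\<close> and a \<open>k\<close>-basis \<open>C\<close> of the commutant measure the dimension of the right \<open>K\<close>-space of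
  left \<open>L\<close>-linear maps.  If \<open>C\<close> were larger than \<open>X\<close>, some nontrivial combination of the left
  multiplications by \<open>C\<close> would vanish on \<open>X\<close>, hence everywhere.  If \<open>X\<close> were larger than \<open>C\<close>, the
  coordinate functions of \<open>X\<close>, which are combinations of those left multiplications, would satisfy a
  nontrivial relation; evaluating it at a point of \<open>X\<close> isolates each coefficient.
\<close>

lemma dim_commutant_eq_card_left_basis:
  fixes L :: "'a set"
  assumes L: "subfield L" "range of_centre \<subseteq> L"
    and basis: "left_basis L X"
  shows "over_centre.dim (commutant L) = card X"
proof -
  have X: "finite X" "left_independent L X"
    "\<And>y. \<exists>u. (\<forall>x\<in>X. u x \<in> L) \<and> y = (\<Sum>x\<in>X. u x * x)"
    using basis by (simp_all add: left_basis_def)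
  obtain C where C: "C \<subseteq> commutant L" "over_centre.independent C"
    "commutant L \<subseteq> over_centre.span C" "card C = over_centre.dim (commutant L)"
    using over_centre.basis_exists by blast
  have finC: "finite C"
    using over_centre.independent_span_bound[OF finA C(2)] spanA by simp
  have "card C \<le> card X"
  proof (rule ccontr)
    assume "\<not> ?thesis"
    then obtain b where nz: "\<exists>c\<in>C. b c \<noteq> 0" and b: "\<And>x. x \<in> X \<Longrightarrow> (\<Sum>c\<in>C. c * x * b c) = 0"
      using homogeneous_system_nontrivial_solution[of X C "\<lambda>x c. c * x"] X(1) finC by auto
    have "(\<Sum>c\<in>C. c * y * b c) = 0" for y
    proof -
      obtain u where u: "\<forall>x\<in>X. u x \<in> L" "y = (\<Sum>x\<in>X. u x * x)" using X(3) by blast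
      have "(\<Sum>c\<in>C. c * y * b c) = (\<Sum>c\<in>C. \<Sum>x\<in>X. c * (u x * x) * b c)"
        by (simp add: u(2) sum_distrib_left sum_distrib_right)
      also have "\<dots> = (\<Sum>c\<in>C. \<Sum>x\<in>X. u x * (c * x * b c))"
      proof (intro sum.cong refl)
        fix c x assume "c \<in> C" "x \<in> X"
        then have "c * u x = u x * c" using C(1) u(1) by (auto simp: commutant_def)
        then show "c * (u x * x) * b c = u x * (c * x * b c)" by (metis mult.assoc)
      qed
      also have "\<dots> = (\<Sum>x\<in>X. u x * (\<Sum>c\<in>C. c * x * b c))"
        by (subst sum.swap) (simp add: sum_distrib_left)
      also have "\<dots> = 0" using b by simp
      finally show ?thesis .
    qed
    then show False using independent_left_factors[OF finC C(2)] nz by blast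
  qed
  moreover have "card X \<le> card C"
  proof (rule ccontr)
    assume less: "\<not> ?thesis"
    \<comment> \<open>\<open>e y x\<close> is the coordinate of \<open>y\<close> at \<open>x\<close>.\<close>
    obtain e where eL: "\<And>y x. x \<in> X \<Longrightarrow> e y x \<in> L" and e: "\<And>y. y = (\<Sum>x\<in>X. e y x * x)"
      using choice[OF allI[OF X(3)]] by metis
    have uniq: "e y x = u x" if "\<And>x. x \<in> X \<Longrightarrow> u x \<in> L" "y = (\<Sum>x\<in>X. u x * x)" "x \<in> X" for y u x
    proof -
      have "(\<Sum>x\<in>X. (e y x - u x) * x) = 0"
        using e[of y] that(2) by (simp add: left_diff_distrib sum_subtractf)
      moreover have "\<forall>x\<in>X. e y x - u x \<in> L"
        using eL that(1) L(1) unfolding subfield_def by (metis diff_conv_add_uminus)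
      ultimately have "e y x - u x = 0"
        using X(2) that(3) unfolding left_independent_def by (auto dest!: spec[of _ "\<lambda>x. e y x - u x"])
      then show ?thesis by simp
    qed
    have add: "e (y + y') x = e y x + e y' x" if "x \<in> X" for y y' x
    proof (rule uniq[of "\<lambda>x. e y x + e y' x", OF _ _ that])
      show "y + y' = (\<Sum>x\<in>X. (e y x + e y' x) * x)"
        using e[of y] e[of y'] by (simp add: distrib_right sum.distrib)
    qed (use eL L(1) in \<open>simp add: subfield_def\<close>)
    have lin: "e (l * y) x = l * e y x" if "l \<in> L" "x \<in> X" for l y x
    proof (rule uniq[of "\<lambda>x. l * e y x", OF _ _ that(2)])
      have "l * y = l * (\<Sum>x\<in>X. e y x * x)" using e[of y] by simp
      then show "l * y = (\<Sum>x\<in>X. l * e y x * x)"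
        by (simp add: sum_distrib_left mult.assoc)
    qed (use eL that L(1) in \<open>simp add: subfield_def\<close>)
    have delta: "e x' x = (if x = x' then 1 else 0)" if "x \<in> X" "x' \<in> X" for x x'
    proof (rule uniq[of "\<lambda>x. if x = x' then 1 else 0", OF _ _ that(1)])
      show "x' = (\<Sum>x\<in>X. (if x = x' then 1 else 0) * x)"
        using that X(1) by (simp add: if_distrib[of "\<lambda>t. t * _"] sum.delta cong: if_cong)
    qed (use L(1) in \<open>simp add: subfield_def\<close>)
    have "\<exists>b. \<forall>y. e y x = (\<Sum>c\<in>C. c * y * b c)" if x: "x \<in> X" for x
    proof -
      have "(\<lambda>y. e y x) \<in> End_centre"
        using add[OF x] lin[OF _ x] L(2) by (simp add: mem_End_centre_iff image_subset_iff)
      then show ?thesis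
        using subfield_linear_map_form[OF _ lin[OF _ x] finC C(3)] by metis
    qed
    then obtain \<beta> where \<beta>: "\<And>x y. x \<in> X \<Longrightarrow> e y x = (\<Sum>c\<in>C. c * y * \<beta> x c)" by metis
    obtain w where nz: "\<exists>x\<in>X. w x \<noteq> 0" and w: "\<And>c. c \<in> C \<Longrightarrow> (\<Sum>x\<in>X. \<beta> x c * w x) = 0"
      using homogeneous_system_nontrivial_solution[of C X "\<lambda>c x. \<beta> x c"] X(1) finC less by auto
    have "w x' = 0" if x': "x' \<in> X" for x'
    proof -
      have "w x' = (\<Sum>x\<in>X. e x' x * w x)"
        using x' X(1) by (simp add: delta if_distrib[of "\<lambda>t. t * _"] sum.delta cong: if_cong)
      also have "\<dots> = (\<Sum>x\<in>X. \<Sum>c\<in>C. c * x' * (\<beta> x c * w x))"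
        by (simp add: \<beta> sum_distrib_right mult.assoc)
      also have "\<dots> = (\<Sum>c\<in>C. c * x' * (\<Sum>x\<in>X. \<beta> x c * w x))"
        by (subst sum.swap) (simp add: sum_distrib_left)
      also have "\<dots> = 0" using w by simp
      finally show ?thesis .
    qed
    then show False using nz by blast
  qed
  ultimately show ?thesis using C(4) by simp
qed

lemma dim_commutant_mult_dim:
  fixes L :: "'a set"
  assumes "subfield L" "range of_centre \<subseteq> L"
  shows "over_centre.dim (commutant L) * over_centre.dim L = over_centre.dim (UNIV :: 'a set)"
proof -
  obtain X where X: "left_basis L X"
    using exists_left_basis[OF assms] by blast
  show ?thesis
    by (simp only: dim_commutant_eq_card_left_basis[OF assms X] dim_UNIV_tower[OF assms X])
qed

end

section \<open>Maximal commutative subfields\<close>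

lemma subfield_commutant: "subfield (commutant S)"
proof -
  have "inverse x * l = l * inverse x" if "x * l = l * x" for x l :: 'a
  proof (cases "x = 0")
    case False
    then have "inverse x * l = inverse x * (l * x) * inverse x" by (simp add: mult.assoc)
    also have "\<dots> = l * inverse x" using False by (simp add: that[symmetric]) (simp flip: mult.assoc)
    finally show ?thesis .
  qed simp
  moreover have "x * y * l = l * (x * y)" if "x * l = l * x" "y * l = l * y" for x y l :: 'a
    using that by (metis mult.assoc)
  ultimately show ?thesis
    by (auto simp: subfield_def commutant_def distrib_left distrib_right)
qed

text \<open>
  The bicommutant replaces the subfield generated by a commuting set: it contains the set, and it is
  commutative because it lies inside the commutant, with which it commutes by definition.
\<close>

lemma commutative_subfield_bicommutant:
  assumes "\<And>x y. x \<in> S \<Longrightarrow> y \<in> S \<Longrightarrow> x * y = y * x"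
  shows "commutative_subfield (commutant (commutant S))"
proof -
  have "S \<subseteq> commutant S" using assms by (auto simp: commutant_def)
  then have "commutant (commutant S) \<subseteq> commutant S" by (auto simp: commutant_def)
  then have "x * y = y * x" if "x \<in> commutant (commutant S)" "y \<in> commutant (commutant S)" for x y
    using that by (auto simp: commutant_def[of "commutant S"])
  then show ?thesis by (simp add: commutative_subfield_def subfield_commutant)
qed

text \<open>
  An element commuting with \<open>L\<close> can be adjoined to \<open>L\<close> without losing commutativity, so by
  maximality it already belongs to \<open>L\<close>.
\<close>

lemma commutant_maximal_commutative_subfield:
  assumes L: "maximal_commutative_subfield L"
  shows "commutant L = L"
proof
  have comm: "\<And>x y. x \<in> L \<Longrightarrow> y \<in> L \<Longrightarrow> x * y = y * x"
    using L by (auto simp: maximal_commutative_subfield_def commutative_subfield_def)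
  show "L \<subseteq> commutant L" using comm by (auto simp: commutant_def)
  show "commutant L \<subseteq> L"
  proof
    fix z assume z: "z \<in> commutant L"
    let ?M = "commutant (commutant (insert z L))"
    have "commutative_subfield ?M"
      by (rule commutative_subfield_bicommutant) (use z comm in \<open>auto simp: commutant_def\<close>)
    moreover have sub: "insert z L \<subseteq> ?M" by (auto simp: commutant_def)
    ultimately have "?M = L"
      using L by (auto simp: maximal_commutative_subfield_def)
    then show "z \<in> L" using sub by blast
  qed
qed

lemma centre_subset_commutant: "range of_centre \<subseteq> commutant L"
  by (auto simp: commutant_def of_centre_commute)

theorem proposition1:
  fixes a :: "nat \<Rightarrow> 'a::division_ring" and d :: nat
  assumes dim: "over_centre.dim (UNIV :: 'a set) = d"
    and basis_inj: "inj_on a {1..d}"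
    and basis_independent: "over_centre.independent (a ` {1..d})"
    and basis_span: "over_centre.span (a ` {1..d}) = UNIV"
  shows "right.basis End_centre {1..d} (\<lambda>i. left_mult (a i)) \<and>
    (\<forall>L :: 'a set. subfield L \<and> range of_centre \<subseteq> L \<longrightarrow>
      over_centre.dim (commutant L) * over_centre.dim L = over_centre.dim (UNIV :: 'a set)) \<and>
    (\<forall>(L :: 'a set) n. maximal_commutative_subfield L \<and> n = over_centre.dim L \<longrightarrow> d = n\<^sup>2)"
proof -
  let ?A = "a ` {1..d}" and ?v = "\<lambda>i. left_mult (a i)"
  have fin: "finite ?A" by simp
  note A = fin basis_independent basis_span
  have "right.span {1..d} ?v = End_centre"
  proof
    show "right.span {1..d} ?v \<subseteq> End_centre"
    proof
      fix f assume "f \<in> right.span {1..d} ?v"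
      then obtain J b where J: "finite J" "f = (\<Sum>i\<in>J. right_scale (?v i) (b i))"
        by (auto simp: right.span_def)
      then show "f \<in> End_centre"
        by (simp add: sum_right_scale_left_mult sum_left_mult_in_End_centre)
    qed
    show "End_centre \<subseteq> right.span {1..d} ?v"
    proof
      fix f :: "'a \<Rightarrow> 'a" assume "f \<in> End_centre"
      then obtain b where b: "\<And>x. f x = (\<Sum>s\<in>?A. s * x * b s)"
        using End_centre_left_form[OF A] by blast
      have "f x = (\<Sum>i\<in>{1..d}. a i * x * b (a i))" for x
        by (simp only: b sum.reindex[OF basis_inj] o_def)
      then have "f = (\<Sum>i\<in>{1..d}. right_scale (?v i) (b (a i)))"
        by (simp add: sum_right_scale_left_mult fun_eq_iff)
      then show "f \<in> right.span {1..d} ?v"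
        unfolding right.span_def by (auto intro!: exI[of _ "{1..d}"] exI[of _ "\<lambda>i. b (a i)"])
    qed
  qed
  then have "right.basis End_centre {1..d} ?v"
    using subspace_End_centre independent_left_mult[OF basis_inj basis_independent]
    by (simp add: right.basis_def)
  moreover have "d = n\<^sup>2" if L: "maximal_commutative_subfield L" and n: "n = over_centre.dim L"
    for L :: "'a set" and n
  proof -
    \<comment> \<open>As a commutant, \<open>L\<close> contains the centre, so the dimension formula applies to it.\<close>
    have eq: "commutant L = L" by (rule commutant_maximal_commutative_subfield[OF L])
    have "range of_centre \<subseteq> L" using centre_subset_commutant[of L] eq by simp
    moreover have "subfield L" using subfield_commutant[of L] eq by simp
    ultimately show ?thesis
      using dim_commutant_mult_dim[OF A, of L] eq dim n by (simp add: power2_eq_square)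
  qed
  ultimately show ?thesis using dim_commutant_mult_dim[OF A] by blast
qed

end
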